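(* Let $d\ge 1$, let $\mathfrak{m}=(c_0,C,\tilde C,U)\in\mathfrak{M}_d$ with $U=(u_{i,j})_{0\le i,j\le d}$, and let $\beta\in\mathbb{C}\setminus(-\mathbb{N}_0)$. Then for all $n\in\mathbb{N}_0^d$ and $x=(x_1,\dots,x_d)\in\mathbb{C}^d$, $$P_n(x;\mathfrak{m},\beta)=\sum_{A=(a_{i,j})}\frac{\prod_{j=1}^{d}(-n_j)_{\sum_{i=1}^{d}a_{i,j}}\;\prod_{i=1}^{d}(-x_i)_{\sum_{j=1}^{d}a_{i,j}}}{(\beta)_{\sum_{i,j=1}^{d}a_{i,j}}}\;\prod_{i,j=1}^{d}\frac{(1-u_{i,j})^{a_{i,j}}}{a_{i,j}!},$$ where the sum is over all $d\times d$ matrices $A=(a_{i,j})_{1\le i,j\le d}$ with entries in $\mathbb{N}_0$ (only finitely many terms are nonzero, since $(-n_j)_{\sum_i a_{i,j}}=0$ when $\sum_{i}a_{i,j}>n_j$).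
   Context: Notation: $\mathbb{N}_0=\{0,1,2,\dots\}$ and $-\mathbb{N}_0=\{0,-1,-2,\dots\}$. For vectors $z\in\mathbb{C}^d$, $n\in\mathbb{N}_0^d$: $z^n=z_1^{n_1}\cdots z_d^{n_d}$, $n!=n_1!\cdots n_d!$, and $|z|=z_1+\cdots+z_d$ (sum of the coordinates, without absolute values). $(a)_k=a(a+1)\cdots(a+k-1)$, $(a)_0=1$, is the Pochhammer symbol; $0^0=1$. Complex powers are taken with the principal branch of the logarithm. The set $\mathfrak{M}_d$: it consists of all 4-tuples $\mathfrak{m}=(c_0,C,\tilde C,U)$, where $c_0$ is a nonzero complex number and $C,\tilde C,U$ are complex $(d+1)\times(d+1)$ matrices (rows and columns indexed by $0,1,\dots,d$) such that (i) $C=\mathrm{diag}(1,-c_1,\dots,-c_d)$ and $\tilde C=\mathrm{diag}(1,-\tilde c_1,\dots,-\tilde c_d)$ are diagonal; (ii) $U=(u_{i,j})_{0\le i,j\le d}$ satisfies $u_{0,j}=u_{j,0}=1$ for all $j=0,1,\dots,d$; (iii) $U^{t}CU\tilde C=c_0I_{d+1}$, where $I_{d+1}$ is the identity matrix. Multivariate Meixner polynomials: for $\mathfrak{m}\in\mathfrak{M}_d$ and $\beta\in\mathbb{C}\setminus(-\mathbb{N}_0)$, the polynomials $P_n(x;\mathfrak{m},\beta)$ in $x=(x_1,\dots,x_d)$, $n\in\mathbb{N}_0^d$, are defined by the expansion, for $z=(z_1,\dots,z_d)$ in a neighborhood of $0$ in $\mathbb{C}^d$, $$(1-|z|)^{-\beta-|x|}\prod_{i=1}^{d}\Big(1-\sum_{j=1}^{d}u_{i,j}z_j\Big)^{x_i}=\sum_{n\in\mathbb{N}_0^d}\frac{(\beta)_{|n|}}{n!}P_n(x;\mathfrak{m},\beta)\,z^n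 .$$ *)

theory Defs
  imports "HOL-Analysis.Analysis"
begin

text \<open>The finite type \<^typ>\<open>'d\<close> plays the role of the index set \<open>{1, \<dots>, d}\<close>, so that
  \<open>d = CARD('d) \<ge> 1\<close>. The index set \<open>{0, 1, \<dots>, d}\<close> is \<^typ>\<open>'d option\<close>, with
  \<^term>\<open>None\<close> for \<open>0\<close> and \<^term>\<open>Some i\<close> for \<open>i\<close>.\<close>

type_synonym 'd ext_mat = "complex ^ 'd option ^ 'd option"

type_synonym 'd meixner_param = "complex \<times> 'd ext_mat \<times> 'd ext_mat \<times> 'd ext_mat"

definition diag_mat :: "('n \<Rightarrow> 'a::zero) \<Rightarrow> 'a ^ 'n ^ 'n" where
  "diag_mat w = (\<chi> i j. if i = j then w i else 0)"

definition meixner_params :: "('d::finite) meixner_param set" where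
  "meixner_params = {(c0, C, C', U).
     c0 \<noteq> 0 \<and>
     (\<exists>c :: complex ^ 'd. C = diag_mat (case_option 1 (\<lambda>i. - c $ i))) \<and>
     (\<exists>c' :: complex ^ 'd. C' = diag_mat (case_option 1 (\<lambda>i. - c' $ i))) \<and>
     (\<forall>j. U $ None $ j = 1 \<and> U $ j $ None = 1) \<and>
     transpose U ** C ** U ** C' = mat c0}"

definition coord_sum :: "('a::comm_monoid_add) ^ ('d::finite) \<Rightarrow> 'a" where
  "coord_sum z = (\<Sum>i\<in>UNIV. z $ i)"

definition multi_power :: "complex ^ ('d::finite) \<Rightarrow> nat ^ 'd \<Rightarrow> complex" where
  "multi_power z n = (\<Prod>i\<in>UNIV. (z $ i) ^ (n $ i))"

definition multi_fact :: "nat ^ ('d::finite) \<Rightarrow> complex" where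
  "multi_fact n = (\<Prod>i\<in>UNIV. fact (n $ i))"

definition meixner_gen ::
  "('d::finite) meixner_param \<Rightarrow> complex \<Rightarrow> complex ^ 'd \<Rightarrow> complex ^ 'd \<Rightarrow> complex" where
  "meixner_gen = (\<lambda>(c0, C, C', U) \<beta> x z.
     (1 - coord_sum z) powr (- \<beta> - coord_sum x) *
     (\<Prod>i\<in>UNIV. (1 - (\<Sum>j\<in>UNIV. U $ Some i $ Some j * z $ j)) powr (x $ i)))"

text \<open>The neighbourhood of \<open>0\<close> on which the expansion holds may depend on \<open>x\<close>. The series over
  multi-indices converges unconditionally, hence absolutely. For \<open>\<beta> \<notin> {0, -1, -2, \<dots>}\<close>
  the factors \<open>(\<beta>)\<^bsub>|n|\<^esub>\<close> do not vanish, so the expansion determines \<open>p\<close>.\<close>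

definition meixner_expansion ::
  "('d::finite) meixner_param \<Rightarrow> complex \<Rightarrow> complex ^ 'd \<Rightarrow> (nat ^ 'd \<Rightarrow> complex) \<Rightarrow> bool" where
  "meixner_expansion \<mm> \<beta> x p \<longleftrightarrow>
     (\<forall>\<^sub>F z in nhds 0.
        ((\<lambda>n. pochhammer \<beta> (coord_sum n) / multi_fact n * p n * multi_power z n)
          has_sum meixner_gen \<mm> \<beta> x z) UNIV)"

definition meixner_poly ::
  "('d::finite) meixner_param \<Rightarrow> complex \<Rightarrow> nat ^ 'd \<Rightarrow> complex ^ 'd \<Rightarrow> complex" where
  "meixner_poly \<mm> \<beta> n x = (THE p. meixner_expansion \<mm> \<beta> x p) n"

end

theory Submission
  imports Defs
begin

text \<open>Put \<open>c = 1 - |z|\<close>, \<open>w = z / c\<close> and \<open>v\<^sub>i\<^sub>j = 1 - u\<^sub>i\<^sub>j\<close>. Then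
  \<open>1 - \<Sum>\<^sub>j u\<^sub>i\<^sub>j z\<^sub>j = c (1 + \<Sum>\<^sub>j v\<^sub>i\<^sub>j w\<^sub>j)\<close>. For small \<open>z\<close> both factors have positive real part, so
  principal powers are multiplicative here and the generating function is
  \<open>c\<^bsup>-\<beta>\<^esup> \<Prod>\<^sub>i (1 + \<Sum>\<^sub>j v\<^sub>i\<^sub>j w\<^sub>j)\<^bsup>x\<^sub>i\<^esup>\<close>. The multivariate binomial series turns the product into a
  series over matrices \<open>A\<close>, in which \<open>w\<close> occurs as \<open>w\<^sup>m\<close> with \<open>m\<close> the vector of column sums of
  \<open>A\<close>. Expanding \<open>c\<^bsup>-\<beta> - |m|\<^esup>\<close> by the same series with summation index \<open>k\<close>, and collecting the terms with
  \<open>k + m = n\<close>, gives the formula, because \<open>(-n)\<^sub>m = (-1)\<^bsup>|m|\<^esup> n! / k!\<close> and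
  \<open>(\<beta>)\<^bsub>|n|\<^esub> = (\<beta>)\<^bsub>|m|\<^esub> (\<beta> + |m|)\<^bsub>|k|\<^esub>\<close>.\<close>

subsection \<open>Multivariate power series\<close>

lemma finite_vec_components:
  fixes B :: "'n::finite \<Rightarrow> 'a set"
  assumes "\<And>i. finite (B i)"
  shows "finite {v :: 'a ^ 'n. \<forall>i. v $ i \<in> B i}"
proof -
  have "{v :: 'a ^ 'n. \<forall>i. v $ i \<in> B i} \<subseteq> vec_lambda ` (PiE UNIV B)"
    by (intro subsetI image_eqI[of _ _ "vec_nth _"]) auto
  moreover have "finite (PiE UNIV B)"
    using assms by (intro finite_PiE) auto
  ultimately show ?thesis
    using finite_subset by blast
qed

lemma finite_coord_sum_eq: "finite {k :: nat ^ 'd::finite. coord_sum k = m}"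
proof (rule finite_subset)
  show "{k :: nat ^ 'd. coord_sum k = m} \<subseteq> {k. \<forall>i. k $ i \<in> {..m}}"
    unfolding coord_sum_def by (auto intro: member_le_sum)
qed (rule finite_vec_components, simp)

lemma coord_sum_add: "coord_sum (k + l) = coord_sum k + coord_sum l"
  by (simp add: coord_sum_def sum.distrib)

lemma coord_sum_axis: "coord_sum (axis j a) = a"
  by (simp add: coord_sum_def axis_def)

text \<open>Both sides satisfy \<open>(m + 1) E\<^bsub>m+1\<^esub> = (\<Sum>\<^sub>i y\<^sub>i) E\<^sub>m\<close>: for the left-hand side, write
  \<open>m + 1 = \<Sum>\<^sub>j k\<^sub>j\<close> and note that \<open>k\<^sub>j y\<^sup>k / k!\<close> is \<open>y\<^sub>j\<close> times the term of \<open>k - e\<^sub>j\<close>.\<close>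

lemma multinomial:
  fixes y :: "'d::finite \<Rightarrow> 'a::field_char_0"
  shows "(\<Sum>k | coord_sum (k :: nat ^ 'd) = m. \<Prod>i\<in>UNIV. y i ^ (k $ i) / fact (k $ i)) =
         (\<Sum>i\<in>UNIV. y i) ^ m / fact m"
proof (induction m)
  case 0
  have "{k :: nat ^ 'd. coord_sum k = 0} = {0}"
    by (auto simp: coord_sum_def vec_eq_iff)
  then show ?case by simp
next
  case (Suc m)
  define e where "e k = (\<Prod>i\<in>UNIV. y i ^ (k $ i) / fact (k $ i))" for k :: "nat ^ 'd"
  let ?S = "\<lambda>m. {k :: nat ^ 'd. coord_sum k = m}"
  have e_axis: "of_nat (Suc (k $ j)) * e (k + axis j 1) = y j * e k" for k j
  proof -
    have "of_nat (Suc (k $ j)) * e (k + axis j 1) =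
        of_nat (Suc (k $ j)) * (y j ^ Suc (k $ j) / fact (Suc (k $ j))) *
          (\<Prod>i\<in>UNIV - {j}. y i ^ (k $ i) / fact (k $ i))"
      unfolding e_def by (subst prod.remove[of _ j]) (auto simp: axis_def intro!: prod.cong)
    also have "of_nat (Suc (k $ j)) * (y j ^ Suc (k $ j) / fact (Suc (k $ j))) =
        y j * (y j ^ (k $ j) / fact (k $ j))"
      by (simp add: divide_simps del: of_nat_Suc)
    finally show ?thesis
      unfolding e_def by (simp add: prod.remove[of _ j] mult.assoc)
  qed
  have "of_nat (Suc m) * (\<Sum>k\<in>?S (Suc m). e k) = (\<Sum>k\<in>?S (Suc m). \<Sum>j\<in>UNIV. of_nat (k $ j) * e k)"
    unfolding sum_distrib_left by (rule sum.cong) (auto simp: coord_sum_def simp flip: sum_distrib_right of_nat_sum)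
  also have "\<dots> = (\<Sum>j\<in>UNIV. \<Sum>k\<in>?S (Suc m). of_nat (k $ j) * e k)"
    by (rule sum.swap)
  also have "\<dots> = (\<Sum>j\<in>UNIV. \<Sum>k\<in>?S m. y j * e k)"
  proof (rule sum.cong)
    fix j :: 'd
    \<comment> \<open>Indices with \<open>k $ j = 0\<close> contribute nothing; once they are
      dropped, the truncated subtraction of \<open>axis j 1\<close> is undone by adding it
      back.\<close>
    have "(\<Sum>k\<in>?S (Suc m). of_nat (k $ j) * e k) =
        (\<Sum>k\<in>{k \<in> ?S (Suc m). k $ j > 0}. of_nat (k $ j) * e k)"
      by (rule sum.mono_neutral_right) (use finite_coord_sum_eq in auto)
    also have "\<dots> = (\<Sum>k\<in>?S m. of_nat (Suc (k $ j)) * e (k + axis j 1))"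
    proof (rule sum.reindex_bij_witness[of _ "\<lambda>k. k + axis j 1" "\<lambda>k. k - axis j 1"])
      fix k assume k: "k \<in> {k \<in> ?S (Suc m). k $ j > 0}"
      then show *: "k - axis j 1 + axis j 1 = k"
        by (auto simp: vec_eq_iff axis_def)
      have "coord_sum k = coord_sum (k - axis j 1) + 1"
        by (subst *[symmetric], simp only: coord_sum_add coord_sum_axis)
      then show "k - axis j 1 \<in> ?S m" using k by simp
      show "of_nat (Suc ((k - axis j 1) $ j)) * e (k - axis j 1 + axis j 1) = of_nat (k $ j) * e k"
        using k unfolding * by (simp del: of_nat_Suc)
    qed (auto simp: coord_sum_add coord_sum_axis vec_eq_iff)
    finally show "(\<Sum>k\<in>?S (Suc m). of_nat (k $ j) * e k) = (\<Sum>k\<in>?S m. y j * e k)"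
      by (simp only: e_axis)
  qed simp
  also have "\<dots> = (\<Sum>j\<in>UNIV. y j) * (\<Sum>k\<in>?S m. e k)"
    by (simp add: sum_product)
  also have "(\<Sum>k\<in>?S m. e k) = (\<Sum>j\<in>UNIV. y j) ^ m / fact m"
    using Suc.IH by (simp add: e_def)
  finally have "(\<Sum>k\<in>?S (Suc m). e k) = (\<Sum>j\<in>UNIV. y j) ^ Suc m / (of_nat (Suc m) * fact m)"
    by (simp add: divide_simps mult_ac del: of_nat_Suc)
  then show ?case
    by (simp add: e_def)
qed

section \<open>Products of unconditionally convergent series\<close>

lemma has_sum_Times_complex:
  fixes f :: "'a \<Rightarrow> complex" and g :: "'b \<Rightarrow> complex"
  assumes f: "(f has_sum s) A" and g: "(g has_sum t) B"
  shows "((\<lambda>(x, y). f x * g y) has_sum (s * t)) (A \<times> B)"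
proof (rule has_sum_SigmaI)
  show "((\<lambda>y. case (x, y) of (x, y) \<Rightarrow> f x * g y) has_sum f x * t) B" for x
    using has_sum_cmult_right[OF g] by simp
  show "((\<lambda>x. f x * t) has_sum (s * t)) A"
    using f by (rule has_sum_cmult_left)
  \<comment> \<open>Over the complex numbers unconditional summability is absolute; summing the
    norms first over \<open>B\<close>, then over \<open>A\<close>, yields the joint summability that
    \<open>has_sum_SigmaI\<close> requires.\<close>
  have f': "(\<lambda>x. norm (f x)) summable_on A" and g': "(\<lambda>x. norm (g x)) summable_on B"
    using f g summable_on_iff_abs_summable_on_complex has_sum_imp_summable by blast+
  have "(\<lambda>p. norm (case p of (x, y) \<Rightarrow> f x * g y)) summable_on A \<times> B"
  proof (rule summable_on_SigmaI)
    show "((\<lambda>y. norm (case (x, y) of (x, y) \<Rightarrow> f x * g y)) has_sum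
        (norm (f x) * infsum (\<lambda>x. norm (g x)) B)) B" for x
      using has_sum_cmult_right[OF has_sum_infsum[OF g']] by (simp add: norm_mult)
    show "(\<lambda>x. norm (f x) * infsum (\<lambda>x. norm (g x)) B) summable_on A"
      using f' by (rule summable_on_cmult_left)
  qed simp
  then show "(\<lambda>(x, y). f x * g y) summable_on A \<times> B"
    by (rule abs_summable_summable)
qed

text \<open>A function on \<open>insert i I\<close> is a value at \<open>i\<close> together with a
  function on \<open>I\<close>, so induction multiplies in one series at a time.\<close>

lemma has_sum_prod_PiE_complex:
  fixes f :: "'a \<Rightarrow> 'b \<Rightarrow> complex"
  assumes "finite I" and "\<And>i. i \<in> I \<Longrightarrow> (f i has_sum s i) (B i)"
  shows "((\<lambda>h. \<Prod>i\<in>I. f i (h i)) has_sum (\<Prod>i\<in>I. s i)) (PiE I B)"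
  using assms
proof (induction I rule: finite_induct)
  case empty
  then show ?case by (simp add: has_sum_finite_iff)
next
  case (insert i I)
  have "((\<lambda>(y, h). f i y * (\<Prod>i\<in>I. f i (h i))) has_sum (s i * (\<Prod>i\<in>I. s i))) (B i \<times> PiE I B)"
    using insert by (intro has_sum_Times_complex) auto
  also have "(\<lambda>(y, h). f i y * (\<Prod>i\<in>I. f i (h i))) =
      (\<lambda>h. \<Prod>i\<in>insert i I. f i (h i)) \<circ> (\<lambda>(y, h). h(i := y))"
    using insert.hyps by (auto simp: fun_eq_iff intro!: prod.cong)
  finally have "((\<lambda>h. \<Prod>i\<in>insert i I. f i (h i)) has_sum (s i * (\<Prod>i\<in>I. s i)))
      ((\<lambda>(y, h). h(i := y)) ` (B i \<times> PiE I B))"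
    by (subst has_sum_reindex[OF inj_combinator[OF insert.hyps(2)]])
  then show ?case
    using insert.hyps by (simp add: PiE_insert_eq)
qed

text \<open>Serves with the rows of a matrix as components: a product of series over row vectors
  becomes one series over matrices.\<close>

lemma has_sum_prod_vec_complex:
  fixes f :: "'n::finite \<Rightarrow> 'b \<Rightarrow> complex"
  assumes "\<And>i. (f i has_sum s i) UNIV"
  shows "((\<lambda>A :: 'b ^ 'n. \<Prod>i\<in>UNIV. f i (A $ i)) has_sum (\<Prod>i\<in>UNIV. s i)) UNIV"
proof -
  have "((\<lambda>h. \<Prod>i\<in>UNIV. f i (h i)) has_sum (\<Prod>i\<in>UNIV. s i)) (PiE UNIV (\<lambda>_. UNIV))"
    using assms by (intro has_sum_prod_PiE_complex) auto
  moreover have "bij_betw vec_nth (UNIV :: ('b ^ 'n) set) (PiE UNIV (\<lambda>_. UNIV))"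
    by (rule bij_betwI[where g = vec_lambda]) auto
  ultimately show ?thesis
    using has_sum_reindex_bij_betw[of vec_nth UNIV "PiE UNIV (\<lambda>_. UNIV)" "\<lambda>h. \<Prod>i\<in>UNIV. f i (h i)"]
    by auto
qed

section \<open>The binomial series in one and several variables\<close>

lemma has_sum_binomial_complex:
  fixes a z :: complex
  assumes "norm z < 1"
  shows "((\<lambda>m. pochhammer a m / fact m * z ^ m) has_sum (1 - z) powr (- a)) UNIV"
proof -
  have eq: "(- a gchoose m) * (- z) ^ m = pochhammer a m / fact m * z ^ m" for m
  proof -
    have "(- 1) ^ m * (- z) ^ m = z ^ m"
      by (simp flip: power_mult_distrib)
    then show ?thesis
      by (simp add: gbinomial_pochhammer mult_ac)
  qed
  have "(\<lambda>m. (- a gchoose m) * (- z) ^ m) sums (1 + (- z)) powr (- a)"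
    using assms by (intro gen_binomial_complex) simp
  \<comment> \<open>\<open>sums\<close> fixes an order of summation; absolute convergence inside the
    disc of convergence makes the sum unconditional.\<close>
  moreover have "summable (\<lambda>m. norm ((- a gchoose m) * (- z) ^ m))"
    using assms by (intro abs_summable_in_conv_radius) (simp_all add: conv_radius_gchoose)
  ultimately show ?thesis
    unfolding eq using norm_summable_imp_has_sum by force
qed

text \<open>On the slice of degree \<open>m\<close>, \<open>multinomial\<close> collapses the terms
  to the \<open>m\<close>-th term of the one-variable binomial series at the sum of the
  \<open>y i\<close>. Bounding the sum of the norms gives absolute convergence across all
  slices.\<close>

lemma has_sum_multinomial_series:
  fixes a :: complex and y :: "'d::finite \<Rightarrow> complex"
  assumes y: "(\<Sum>i\<in>UNIV. norm (y i)) < 1"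
  shows "((\<lambda>k :: nat ^ 'd. pochhammer a (coord_sum k) * (\<Prod>i\<in>UNIV. y i ^ (k $ i) / fact (k $ i)))
           has_sum (1 - (\<Sum>i\<in>UNIV. y i)) powr (- a)) UNIV"
proof -
  define S where "S m = {k :: nat ^ 'd. coord_sum k = m}" for m
  define f where "f = (\<lambda>(m, k :: nat ^ 'd). pochhammer a m * (\<Prod>i\<in>UNIV. y i ^ (k $ i) / fact (k $ i)))"
  have fin: "finite (S m)" for m
    unfolding S_def by (rule finite_coord_sum_eq)
  have "norm (\<Sum>i\<in>UNIV. y i) < 1"
    using y norm_sum[of y UNIV] by linarith
  then have 1: "((\<lambda>m. pochhammer a m / fact m * (\<Sum>i\<in>UNIV. y i) ^ m)
      has_sum (1 - (\<Sum>i\<in>UNIV. y i)) powr (- a)) UNIV"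
    by (rule has_sum_binomial_complex)
  \<comment> \<open>The one-variable series at the sum of the \<open>norm (y i)\<close> is the
    majorant: the norm of its \<open>m\<close>-th term equals the sum of the norms over the slice of
    degree \<open>m\<close>.\<close>
  have "norm (complex_of_real (\<Sum>i\<in>UNIV. norm (y i))) < 1"
    using y by (simp add: sum_nonneg del: of_real_sum)
  from has_sum_imp_summable[OF has_sum_binomial_complex[OF this, of a]]
  have 2: "(\<lambda>m. norm (pochhammer a m / fact m * complex_of_real (\<Sum>i\<in>UNIV. norm (y i)) ^ m)) summable_on UNIV"
    by (simp only: summable_on_iff_abs_summable_on_complex)
  have "(\<lambda>p. norm (f p)) summable_on Sigma UNIV S"
  proof (rule summable_on_SigmaI[OF _ 2])
    fix m :: nat
    have "(\<Sum>k\<in>S m. norm (f (m, k))) =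
        norm (pochhammer a m) * (\<Sum>k\<in>S m. \<Prod>i\<in>UNIV. norm (y i) ^ (k $ i) / fact (k $ i))"
      by (simp add: f_def norm_mult norm_divide norm_power sum_distrib_left flip: prod_norm)
    also have "\<dots> = norm (pochhammer a m / fact m * complex_of_real (\<Sum>i\<in>UNIV. norm (y i)) ^ m)"
      unfolding S_def multinomial by (simp add: norm_mult norm_divide norm_power sum_nonneg del: of_real_sum)
    finally show "((\<lambda>k. norm (f (m, k))) has_sum
        norm (pochhammer a m / fact m * complex_of_real (\<Sum>i\<in>UNIV. norm (y i)) ^ m)) (S m)"
      using fin by (simp add: has_sum_finite_iff)
  qed simp
  then have 3: "f summable_on Sigma UNIV S"
    by (rule abs_summable_summable)
  have "(f has_sum (1 - (\<Sum>i\<in>UNIV. y i)) powr (- a)) (Sigma UNIV S)"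
  proof (rule has_sum_SigmaI[OF _ 1 3])
    fix m :: nat
    have "(\<Sum>k\<in>S m. f (m, k)) = pochhammer a m * (\<Sum>k\<in>S m. \<Prod>i\<in>UNIV. y i ^ (k $ i) / fact (k $ i))"
      by (simp add: f_def sum_distrib_left)
    then show "((\<lambda>k. f (m, k)) has_sum pochhammer a m / fact m * (\<Sum>i\<in>UNIV. y i) ^ m) (S m)"
      using fin by (simp add: has_sum_finite_iff S_def multinomial)
  qed
  moreover have "bij_betw (\<lambda>k. (coord_sum k, k)) UNIV (Sigma UNIV S)"
    by (rule bij_betwI[where g = snd]) (auto simp: S_def)
  ultimately show ?thesis
    using has_sum_reindex_bij_betw[of "\<lambda>k. (coord_sum k, k)" UNIV "Sigma UNIV S" f]
    by (simp add: f_def)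
qed

section \<open>Uniqueness of power series coefficients\<close>

lemma powser_zero_imp_coeff_zero:
  fixes a :: "nat \<Rightarrow> complex"
  assumes "\<epsilon> > 0" and "\<And>t. norm t < \<epsilon> \<Longrightarrow> (\<lambda>n. a n * t ^ n) sums 0"
  shows "a n = 0"
proof (induction n rule: less_induct)
  case (less n)
  \<comment> \<open>The earlier coefficients vanish by induction, so \<open>t ^ n\<close> can be
    divided out away from \<open>0\<close>; the limit at \<open>0\<close> of what remains is its
    constant coefficient \<open>a n\<close>.\<close>
  have "(\<lambda>k. a (k + n) * t ^ k) sums 0" if t: "t \<noteq> 0" "norm t < \<epsilon>" for t
  proof -
    have "(\<lambda>k. a (k + n) * t ^ (k + n)) sums (0 - (\<Sum>k<n. a k * t ^ k))"
      using assms(2)[OF t(2)] by (rule sums_split_initial_segment)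
    then have "(\<lambda>k. a (k + n) * t ^ (k + n) / t ^ n) sums 0"
      using sums_divide[of _ 0 "t ^ n"] less by simp
    then show ?thesis using t by (simp add: power_add)
  qed
  then have "((\<lambda>_. 0) \<longlongrightarrow> a (0 + n)) (at (0 :: complex))"
    by (intro powser_limit_0_strong[OF assms(1)])
  then show ?case
    by (simp add: tendsto_const_iff)
qed

text \<open>Restricting the support to \<open>S\<close> permits induction on the set of variables:
  the series is a power series in a new variable \<open>a\<close> whose coefficients are series
  supported on \<open>S\<close>. Bounding each coordinate, not the norm, lets one variable move
  while the others stay fixed.\<close>

lemma multi_powser_zero_imp_coeff_zero_supported:
  fixes c :: "nat ^ 'd::finite \<Rightarrow> complex"
  assumes "finite S" and "\<epsilon> > 0"
    and "\<And>z :: complex ^ 'd. (\<And>j. norm (z $ j) < \<epsilon>) \<Longrightarrow>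
      ((\<lambda>n. c n * multi_power z n) has_sum 0) {n. \<forall>j. j \<notin> S \<longrightarrow> n $ j = 0}"
    and "\<And>j. j \<notin> S \<Longrightarrow> n $ j = 0"
  shows "c n = 0"
  using assms(1,3,4)
proof (induction S arbitrary: c n rule: finite_induct)
  case empty
  have "{n :: nat ^ 'd. \<forall>j. n $ j = 0} = {n}"
    using empty.prems(2) by (auto simp: vec_eq_iff)
  with empty.prems(1)[of 0] empty.prems(2) \<open>\<epsilon> > 0\<close> show ?case
    by (simp add: has_sum_finite_iff multi_power_def)
next
  case (insert a S)
  define I where "I S = {n :: nat ^ 'd. \<forall>j. j \<notin> S \<longrightarrow> n $ j = 0}" for S
  define upd where "upd n l = (\<chi> j. if j = a then l else n $ j)" for n :: "nat ^ 'd" and l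
  define n' where "n' = (\<chi> j. if j = a then 0 else n $ j)"
  have n: "n = upd n' (n $ a)"
    by (simp add: upd_def n'_def vec_eq_iff)
  have "((\<lambda>m. c (upd m l) * multi_power z m) has_sum 0) (I S)"
    if z: "\<And>j. norm (z $ j) < \<epsilon>" for z :: "complex ^ 'd" and l
  proof -
    let ?f = "\<lambda>l m. c (upd m l) * multi_power z m"
    have *: "((\<lambda>(l, m). t ^ l * ?f l m) has_sum 0) (UNIV \<times> I S)"
      if t: "norm t < \<epsilon>" for t
    proof -
      define z' where "z' = (\<chi> j. if j = a then t else z $ j)"
      have "((\<lambda>n. c n * multi_power z' n) has_sum 0) (I (insert a S))"
        unfolding I_def using t z by (intro insert.prems(1)) (simp add: z'_def)
      also have "?this \<longleftrightarrow> ?thesis"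
      proof (rule has_sum_reindex_bij_witness[of _ "\<lambda>(l, m). upd m l"
            "\<lambda>n. (n $ a, \<chi> j. if j = a then 0 else n $ j)"])
        fix n assume "n \<in> I (insert a S)"
        have "multi_power z' n = t ^ (n $ a) * (\<Prod>j\<in>UNIV - {a}. (z $ j) ^ (n $ j))"
          unfolding multi_power_def by (subst prod.remove[of _ a]) (auto simp: z'_def intro!: prod.cong)
        moreover have "multi_power z (\<chi> j. if j = a then 0 else n $ j) = (\<Prod>j\<in>UNIV - {a}. (z $ j) ^ (n $ j))"
          unfolding multi_power_def by (subst prod.remove[of _ a]) (auto intro!: prod.cong)
        moreover have "upd (\<chi> j. if j = a then 0 else n $ j) (n $ a) = n"
          by (simp add: upd_def vec_eq_iff)
        ultimately show "(case (n $ a, \<chi> j. if j = a then 0 else n $ j) of (l, m) \<Rightarrow> t ^ l * ?f l m) =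
            c n * multi_power z' n"
          by simp
      qed (use insert.hyps in \<open>auto simp: I_def upd_def vec_eq_iff\<close>)
      finally show ?thesis .
    qed
    have summ: "?f l summable_on I S" for l
    proof -
      \<comment> \<open>A nonzero point of the disc, so that \<open>t ^ l\<close> can be
        cancelled.\<close>
      define t where "t = complex_of_real (\<epsilon> / 2)"
      have "(\<lambda>(l, m). t ^ l * ?f l m) summable_on (UNIV \<times> I S)"
        using *[of t] \<open>\<epsilon> > 0\<close> has_sum_imp_summable by (force simp: t_def)
      then have "(\<lambda>m. t ^ l * ?f l m) summable_on I S"
        by (rule summable_on_SigmaD1) simp
      then show ?thesis
        using \<open>\<epsilon> > 0\<close> by (subst (asm) summable_on_cmult_right') (auto simp: t_def)
    qed
    \<comment> \<open>Summed over the other exponents first, the series is a power series in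
      \<open>t\<close> that vanishes on the disc, so one-variable uniqueness applies.\<close>
    have "infsum (?f l) (I S) = 0"
    proof (rule powser_zero_imp_coeff_zero[OF \<open>\<epsilon> > 0\<close>])
      fix t :: complex assume "norm t < \<epsilon>"
      from has_sum_SigmaD[OF *[OF this], of "\<lambda>l. t ^ l * infsum (?f l) (I S)"]
      have "((\<lambda>l. t ^ l * infsum (?f l) (I S)) has_sum 0) UNIV"
        using summ by (simp add: has_sum_cmult_right)
      then show "(\<lambda>l. infsum (?f l) (I S) * t ^ l) sums 0"
        using has_sum_imp_sums by (simp add: mult.commute)
    qed
    with summ show ?thesis
      by (metis has_sum_infsum)
  qed
  \<comment> \<open>Clearing the entry at \<open>a\<close> gives \<open>n'\<close> supported on
    \<open>S\<close>; the induction hypothesis is used for the slice with exponent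
    \<open>n $ a\<close>.\<close>
  then have "c (upd n' (n $ a)) = 0"
    using insert.prems(2) by (intro insert.IH[where n = n' and c = "\<lambda>m. c (upd m (n $ a))"])
      (auto simp: I_def n'_def)
  then show ?case by (simp flip: n)
qed

lemma multi_powser_zero_imp_coeff_zero:
  fixes c :: "nat ^ 'd::finite \<Rightarrow> complex"
  assumes "\<forall>\<^sub>F z in nhds 0. ((\<lambda>n. c n * multi_power z n) has_sum 0) UNIV"
  shows "c n = 0"
proof -
  obtain \<epsilon> where \<epsilon>: "\<epsilon> > 0"
    and sum: "\<And>z. norm z < \<epsilon> \<Longrightarrow> ((\<lambda>n. c n * multi_power z n) has_sum 0) UNIV"
    using assms by (auto simp: eventually_nhds_metric)
  show ?thesis
  \<comment> \<open>The norm is at most the sum of the coordinate norms, so the polydisc of this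
    radius lies in the ball of radius \<open>\<epsilon>\<close>.\<close>
  proof (rule multi_powser_zero_imp_coeff_zero_supported[of UNIV "\<epsilon> / CARD('d)"])
    fix z :: "complex ^ 'd" assume z: "\<And>j. norm (z $ j) < \<epsilon> / CARD('d)"
    have "norm z \<le> (\<Sum>j\<in>UNIV. norm (z $ j))"
      unfolding norm_vec_def by (rule L2_set_le_sum) simp
    also have "\<dots> < (\<Sum>j\<in>(UNIV :: 'd set). \<epsilon> / CARD('d))"
      using z by (intro sum_strict_mono) auto
    finally show "((\<lambda>n. c n * multi_power z n) has_sum 0) {n. \<forall>j. j \<notin> UNIV \<longrightarrow> n $ j = 0}"
      using sum by simp
  qed (use \<epsilon> in auto)
qed

section \<open>Pochhammer symbols, a real majorant and principal powers\<close>

lemma norm_pochhammer_le: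
  fixes a :: "'a::real_normed_field"
  assumes "norm a \<le> b"
  shows "norm (pochhammer a n) \<le> pochhammer b n"
proof -
  have "norm (a + of_nat i) \<le> b + of_nat i" for i
    using norm_triangle_ineq[of a "of_nat i"] assms by simp
  then show ?thesis
    unfolding pochhammer_prod prod_norm[symmetric] by (intro prod_mono) auto
qed

text \<open>The form \<open>k + m\<close> covers exactly the non-vanishing case and keeps truncated
  subtraction out of the identity.\<close>

lemma pochhammer_neg_of_nat_add:
  "pochhammer (- of_nat (k + m)) m = ((-1) ^ m * fact (k + m) / fact k :: 'a::field_char_0)"
proof -
  have "pochhammer (- of_nat (k + m)) m = ((-1) ^ m * pochhammer (of_nat k + 1) m :: 'a)"
    by (subst pochhammer_minus) simp
  also have "pochhammer (of_nat k + 1) m = (fact (k + m) / fact k :: 'a)"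
  proof -
    have "fact (k + m) = (fact k * pochhammer (1 + of_nat k) m :: 'a)"
      by (simp only: pochhammer_fact pochhammer_product')
    then show ?thesis by (simp add: add.commute)
  qed
  finally show ?thesis by simp
qed

text \<open>Evaluates the majorant built from the \<open>norm (z $ j)\<close>. It is the complex
  series read through \<open>of_real\<close>, where the two powers agree because the base is
  nonnegative.\<close>

lemma has_sum_multinomial_series_real:
  fixes a :: real and y :: "'d::finite \<Rightarrow> real"
  assumes y: "(\<Sum>i\<in>UNIV. \<bar>y i\<bar>) < 1"
  shows "((\<lambda>k :: nat ^ 'd. pochhammer a (coord_sum k) * (\<Prod>i\<in>UNIV. y i ^ (k $ i) / fact (k $ i)))
           has_sum (1 - (\<Sum>i\<in>UNIV. y i)) powr (- a)) UNIV"
proof -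
  have eq: "pochhammer (complex_of_real a) (coord_sum k) *
        (\<Prod>i\<in>UNIV. complex_of_real (y i) ^ (k $ i) / fact (k $ i)) =
      of_real (pochhammer a (coord_sum k) * (\<Prod>i\<in>UNIV. y i ^ (k $ i) / fact (k $ i)))" for k
    by (simp add: pochhammer_of_real)
  have "(\<Sum>i\<in>UNIV. y i) \<le> 1"
    using y sum_mono[of UNIV y "\<lambda>i. \<bar>y i\<bar>"] by fastforce
  then have "(1 - (\<Sum>i\<in>UNIV. complex_of_real (y i))) powr (- of_real a) =
      of_real ((1 - (\<Sum>i\<in>UNIV. y i)) powr (- a))"
    by (simp flip: powr_of_real)
  with has_sum_multinomial_series[of "\<lambda>i. complex_of_real (y i)" "of_real a"] y show ?thesis
    unfolding eq by (simp add: has_sum_of_real_iff del: of_real_mult of_real_prod)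
qed

text \<open>Both arguments lie strictly between \<open>-pi/2\<close> and \<open>pi/2\<close>, so
  their sum stays inside the principal range and the logarithms add.\<close>

lemma powr_mult_Re_pos:
  fixes z w :: complex
  assumes "Re z > 0" "Re w > 0"
  shows "(z * w) powr a = z powr a * w powr a"
proof -
  have "z \<noteq> 0" "w \<noteq> 0"
    using assms by auto
  moreover have "Ln (z * w) = Ln z + Ln w"
    using Re_Ln_pos_lt_imp[OF assms(1)] Re_Ln_pos_lt_imp[OF assms(2)] \<open>z \<noteq> 0\<close> \<open>w \<noteq> 0\<close>
    by (intro Ln_times_simple) linarith+
  ultimately show ?thesis
    by (simp add: powr_def distrib_left exp_add)
qed

subsection \<open>Expansion of the generating function\<close>

definition col_sum :: "nat ^ 'd ^ 'd \<Rightarrow> nat ^ ('d::finite)" where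
  "col_sum A = (\<chi> j. \<Sum>i\<in>UNIV. A $ i $ j)"

definition meixner_term ::
  "complex \<Rightarrow> ('d \<Rightarrow> 'd \<Rightarrow> complex) \<Rightarrow> complex ^ 'd \<Rightarrow> nat ^ 'd \<Rightarrow> nat ^ 'd ^ ('d::finite) \<Rightarrow> complex" where
  "meixner_term \<beta> v x n A =
     (\<Prod>j\<in>UNIV. pochhammer (- of_nat (n $ j)) (\<Sum>i\<in>UNIV. A $ i $ j)) *
     (\<Prod>i\<in>UNIV. pochhammer (- x $ i) (\<Sum>j\<in>UNIV. A $ i $ j)) /
     pochhammer \<beta> (\<Sum>i\<in>UNIV. \<Sum>j\<in>UNIV. A $ i $ j) *
     (\<Prod>i\<in>UNIV. \<Prod>j\<in>UNIV. v i j ^ (A $ i $ j) / fact (A $ i $ j))"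

text \<open>The contribution of \<open>A\<close> to the product of the powers \<open>x $ i\<close>;
  the minus signs come from the shape \<open>(1 - y) powr (- a)\<close> of the multinomial series,
  taken with \<open>a = - x $ i\<close>.\<close>

definition row_coeff ::
  "('d \<Rightarrow> 'd \<Rightarrow> complex) \<Rightarrow> complex ^ 'd \<Rightarrow> nat ^ 'd ^ ('d::finite) \<Rightarrow> complex" where
  "row_coeff v x A =
     (\<Prod>i\<in>UNIV. pochhammer (- x $ i) (coord_sum (A $ i)) *
       (\<Prod>j\<in>UNIV. (- v i j) ^ (A $ i $ j) / fact (A $ i $ j)))"

lemma multi_power_add: "multi_power z (k + m) = multi_power z k * multi_power z m"
  by (simp add: multi_power_def power_add prod.distrib)

lemma multi_power_divide:
  "multi_power (\<chi> j. z $ j / c) m = multi_power z m / c ^ coord_sum m"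
  by (simp add: multi_power_def coord_sum_def power_divide prod_dividef power_sum)

lemma multi_power_col_sum:
  "multi_power w (col_sum A) = (\<Prod>i\<in>UNIV. \<Prod>j\<in>UNIV. (w $ j) ^ (A $ i $ j))"
  unfolding multi_power_def col_sum_def by (subst prod.swap) (simp add: power_sum)

lemma coord_sum_col_sum: "coord_sum (col_sum A) = (\<Sum>i\<in>UNIV. \<Sum>j\<in>UNIV. A $ i $ j)"
  unfolding coord_sum_def col_sum_def by (subst sum.swap) simp

text \<open>A contributing matrix has every sum over column \<open>j\<close>, hence every entry of
  that column, at most \<open>n $ j\<close>.\<close>

lemma finite_meixner_term: "finite {A. meixner_term \<beta> v x n A \<noteq> 0}"
proof (rule finite_subset)
  show "{A. meixner_term \<beta> v x n A \<noteq> 0} \<subseteq> {A. \<forall>i. A $ i \<in> {k. \<forall>j. k $ j \<in> {..n $ j}}}"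
  proof (intro subsetI CollectI allI)
    fix A i j assume A: "A \<in> {A. meixner_term \<beta> v x n A \<noteq> 0}"
    then have "pochhammer (- of_nat (n $ j) :: complex) (\<Sum>i\<in>UNIV. A $ i $ j) \<noteq> 0"
      by (auto simp: meixner_term_def)
    then have "(\<Sum>i\<in>UNIV. A $ i $ j) \<le> n $ j"
      by (simp add: pochhammer_of_nat_eq_0_iff)
    then show "A $ i $ j \<in> {..n $ j}"
      using member_le_sum[of i UNIV "\<lambda>i. A $ i $ j"] by simp
  qed
qed (intro finite_vec_components, simp)

text \<open>Allows a sum over pairs with \<open>col_sum A \<le> n\<close> to be extended to all
  pairs.\<close>

lemma meixner_term_eq_0:
  assumes "\<not> col_sum A \<le> n"
  shows "meixner_term \<beta> v x n A = 0"
proof -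
  obtain j where "n $ j < (\<Sum>i\<in>UNIV. A $ i $ j)"
    using assms by (auto simp: less_eq_vec_def col_sum_def not_le)
  then have "pochhammer (- of_nat (n $ j) :: complex) (\<Sum>i\<in>UNIV. A $ i $ j) = 0"
    by (simp add: pochhammer_of_nat_eq_0_iff)
  then show ?thesis
    unfolding meixner_term_def by (subst prod_zero[of UNIV]) auto
qed

text \<open>The sign from the symbols in \<open>- n $ j\<close> cancels against that of
  \<open>- v\<close> in \<open>row_coeff\<close>; the condition on \<open>\<beta>\<close> makes the
  denominator \<open>pochhammer \<beta> (coord_sum m)\<close> nonzero, so it cancels too.\<close>

lemma meixner_term_add_col_sum:
  fixes A :: "nat ^ 'd ^ 'd::finite"
  assumes \<beta>: "\<beta> \<notin> \<int>\<^sub>\<le>\<^sub>0"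
  shows "pochhammer \<beta> (coord_sum (k + col_sum A)) / multi_fact (k + col_sum A) *
      meixner_term \<beta> v x (k + col_sum A) A =
    row_coeff v x A * pochhammer (\<beta> + of_nat (coord_sum (col_sum A))) (coord_sum k) / multi_fact k"
proof -
  define m where "m = col_sum A"
  have "pochhammer \<beta> (coord_sum m) \<noteq> 0"
    using \<beta> by (auto simp: pochhammer_eq_0_iff)
  moreover have "pochhammer \<beta> (coord_sum (k + m)) =
      pochhammer \<beta> (coord_sum m) * pochhammer (\<beta> + of_nat (coord_sum m)) (coord_sum k)"
    by (simp add: coord_sum_add pochhammer_product' add.commute[of "coord_sum k"])
  moreover have "multi_fact (k + m) \<noteq> 0"
    by (simp add: multi_fact_def)
  moreover have "(\<Prod>j\<in>UNIV. pochhammer (- of_nat ((k + m) $ j)) (m $ j)) =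
      (-1) ^ coord_sum m * multi_fact (k + m) / multi_fact k"
    by (simp only: vector_add_component pochhammer_neg_of_nat_add)
      (simp add: multi_fact_def coord_sum_def power_sum prod.distrib prod_dividef)
  moreover have "(\<Prod>i\<in>UNIV. \<Prod>j\<in>UNIV. (- v i j) ^ (A $ i $ j) / fact (A $ i $ j)) =
      (-1) ^ coord_sum m * (\<Prod>i\<in>UNIV. \<Prod>j\<in>UNIV. v i j ^ (A $ i $ j) / fact (A $ i $ j))"
    by (simp add: power_minus[of "v _ _"] m_def coord_sum_col_sum power_sum prod.distrib
        flip: times_divide_eq_right)
  moreover have "m $ j = (\<Sum>i\<in>UNIV. A $ i $ j)" for j
    by (simp add: m_def col_sum_def)
  moreover have "coord_sum m = (\<Sum>i\<in>UNIV. \<Sum>j\<in>UNIV. A $ i $ j)"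
    by (simp add: m_def coord_sum_col_sum)
  ultimately show ?thesis
    unfolding meixner_term_def row_coeff_def m_def[symmetric]
    by (simp add: prod.distrib coord_sum_def[of "A $ _"])
qed

text \<open>Row \<open>i\<close> is the multinomial series with parameter \<open>- x $ i\<close> at
  the point \<open>- v i j * w $ j\<close>; the rows are summed independently.\<close>

lemma has_sum_row_coeff:
  fixes v :: "'d::finite \<Rightarrow> 'd \<Rightarrow> complex"
  assumes "\<And>i. (\<Sum>j\<in>UNIV. norm (v i j * w $ j)) < 1"
  shows "((\<lambda>A. row_coeff v x A * multi_power w (col_sum A)) has_sum
           (\<Prod>i\<in>UNIV. (1 + (\<Sum>j\<in>UNIV. v i j * w $ j)) powr (x $ i))) UNIV"
proof -
  have "((\<lambda>A :: nat ^ 'd ^ 'd. \<Prod>i\<in>UNIV. pochhammer (- x $ i) (coord_sum (A $ i)) *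
        (\<Prod>j\<in>UNIV. (- v i j * w $ j) ^ (A $ i $ j) / fact (A $ i $ j))) has_sum
      (\<Prod>i\<in>UNIV. (1 - (\<Sum>j\<in>UNIV. - v i j * w $ j)) powr (- (- x $ i)))) UNIV"
    using assms by (intro has_sum_prod_vec_complex has_sum_multinomial_series) simp
  moreover have "(\<Prod>i\<in>UNIV. pochhammer (- x $ i) (coord_sum (A $ i)) *
        (\<Prod>j\<in>UNIV. (- v i j * w $ j) ^ (A $ i $ j) / fact (A $ i $ j))) =
      row_coeff v x A * multi_power w (col_sum A)" for A
    unfolding row_coeff_def multi_power_col_sum power_mult_distrib
    by (simp add: prod.distrib prod_dividef)
  ultimately show ?thesis
    by (simp add: sum_negf)
qed

section \<open>Rescaling by \<open>1 - coord_sum z\<close>\<close>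

lemma Re_one_minus_coord_sum_pos:
  fixes z :: "complex ^ 'd::finite"
  assumes "(\<Sum>j\<in>UNIV. norm (z $ j)) < 1"
  shows "Re (1 - coord_sum z) > 0"
  using assms abs_Re_le_cmod[of "coord_sum z"] norm_sum[of "\<lambda>j. z $ j" UNIV]
  by (simp add: coord_sum_def)

text \<open>The modulus of \<open>1 - coord_sum z\<close> is at least \<open>1 - r\<close>. The
  condition with denominator \<open>1 - r\<close> thus controls the series itself as well as its
  majorant.\<close>

lemma sum_norm_rescaled_less_1:
  fixes z :: "complex ^ 'd::finite" and v :: "'d \<Rightarrow> complex"
  defines "r \<equiv> \<Sum>j\<in>UNIV. norm (z $ j)"
  assumes r: "r < 1" and v: "(\<Sum>j\<in>UNIV. norm (v j) * (norm (z $ j) / (1 - r))) < 1"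
  shows "(\<Sum>j\<in>UNIV. norm (v j * (z $ j / (1 - coord_sum z)))) < 1"
proof (rule order_le_less_trans[OF sum_mono v])
  fix j :: 'd
  have "1 - r \<le> norm (1 - coord_sum z)"
    using norm_triangle_ineq2[of 1 "coord_sum z"] norm_sum[of "\<lambda>j. z $ j" UNIV]
    by (simp add: r_def coord_sum_def)
  then have "norm (z $ j) / norm (1 - coord_sum z) \<le> norm (z $ j) / (1 - r)"
    using r by (intro divide_left_mono mult_pos_pos) auto
  then show "norm (v j * (z $ j / (1 - coord_sum z))) \<le> norm (v j) * (norm (z $ j) / (1 - r))"
    by (simp add: norm_mult norm_divide mult_left_mono flip: times_divide_eq_right)
qed

lemma meixner_gen_eq:
  fixes z :: "complex ^ 'd::finite" and U :: "complex ^ 'd option ^ 'd option"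
  defines "c \<equiv> 1 - coord_sum z"
  defines "w \<equiv> \<chi> j. z $ j / c"
  assumes c: "Re c > 0"
    and w: "\<And>i. (\<Sum>j\<in>UNIV. norm ((1 - U $ Some i $ Some j) * w $ j)) < 1"
  shows "meixner_gen (c0, C, C', U) \<beta> x z =
    c powr (- \<beta>) * (\<Prod>i\<in>UNIV. (1 + (\<Sum>j\<in>UNIV. (1 - U $ Some i $ Some j) * w $ j)) powr (x $ i))"
proof -
  define s where "s i = (\<Sum>j\<in>UNIV. (1 - U $ Some i $ Some j) * w $ j)" for i
  have [simp]: "c \<noteq> 0" using c by auto
  have factor: "(1 - (\<Sum>j\<in>UNIV. U $ Some i $ Some j * z $ j)) powr (x $ i) =
      c powr (x $ i) * (1 + s i) powr (x $ i)" for i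
  proof -
    \<comment> \<open>This puts \<open>1 + s i\<close> in the right half-plane, where principal
      powers multiply.\<close>
    have "norm (s i) < 1"
      unfolding s_def by (rule order_le_less_trans[OF norm_sum w])
    then have "Re (1 + s i) > 0"
      using abs_Re_le_cmod[of "s i"] by simp
    moreover have "c * s i = (\<Sum>j\<in>UNIV. (1 - U $ Some i $ Some j) * z $ j)"
      by (simp add: s_def w_def sum_distrib_left)
    then have "1 - (\<Sum>j\<in>UNIV. U $ Some i $ Some j * z $ j) = c * (1 + s i)"
      by (simp add: distrib_left left_diff_distrib sum_subtractf c_def coord_sum_def)
    ultimately show ?thesis
      using c by (simp add: powr_mult_Re_pos)
  qed
  \<comment> \<open>The powers of \<open>c\<close> taken out of the factors cancel the exponent
    \<open>- coord_sum x\<close>.\<close>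
  have "(\<Prod>i\<in>UNIV. c powr (x $ i)) = c powr coord_sum x"
    by (simp add: powr_def coord_sum_def sum_distrib_right exp_sum)
  moreover have "c powr (- \<beta> - coord_sum x) * c powr coord_sum x = c powr (- \<beta>)"
    by (simp flip: powr_add)
  ultimately show ?thesis
    by (simp add: meixner_gen_def factor prod.distrib s_def[symmetric] flip: c_def mult.assoc)
qed

text \<open>Absolute convergence: the series is majorized by the one for \<open>|\<beta>|\<close> and \<open>|z\<^sub>j|\<close>, whose inner
  sums over \<open>k\<close> have a closed form that \<open>has_sum_row_coeff\<close> shows to be summable over \<open>A\<close>.\<close>

lemma has_sum_double_series:
  fixes z :: "complex ^ 'd::finite" and v :: "'d \<Rightarrow> 'd \<Rightarrow> complex"
  defines "r \<equiv> \<Sum>j\<in>UNIV. norm (z $ j)"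
  defines "c \<equiv> 1 - coord_sum z"
  assumes r: "r < 1" and v: "\<And>i. (\<Sum>j\<in>UNIV. norm (v i j) * (norm (z $ j) / (1 - r))) < 1"
  shows "((\<lambda>(A, k). row_coeff v x A * pochhammer (\<beta> + of_nat (coord_sum (col_sum A))) (coord_sum k) /
            multi_fact k * multi_power z (k + col_sum A)) has_sum
          c powr (- \<beta>) * (\<Prod>i\<in>UNIV. (1 + (\<Sum>j\<in>UNIV. v i j * (z $ j / c))) powr (x $ i)))
         (UNIV \<times> UNIV)"
proof -
  define f where "f = (\<lambda>(A :: nat ^ 'd ^ 'd, k :: nat ^ 'd).
    row_coeff v x A * multi_power z (col_sum A) *
      (pochhammer (\<beta> + of_nat (coord_sum (col_sum A))) (coord_sum k) *
        (\<Prod>i\<in>UNIV. (z $ i) ^ (k $ i) / fact (k $ i))))"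
  have f_eq: "f = (\<lambda>(A, k). row_coeff v x A *
      pochhammer (\<beta> + of_nat (coord_sum (col_sum A))) (coord_sum k) /
        multi_fact k * multi_power z (k + col_sum A))"
    by (auto simp: f_def fun_eq_iff multi_power_add multi_power_def[of z "_ :: nat ^ 'd"]
        multi_fact_def prod_dividef)
  have "c \<noteq> 0" and w: "\<And>i. (\<Sum>j\<in>UNIV. norm (v i j * (\<chi> j. z $ j / c) $ j)) < 1"
    using Re_one_minus_coord_sum_pos[of z] sum_norm_rescaled_less_1[of z] r v
    by (auto simp: r_def c_def)
  from w have "((\<lambda>A. row_coeff v x A * multi_power (\<chi> j. z $ j / c) (col_sum A)) has_sum
      (\<Prod>i\<in>UNIV. (1 + (\<Sum>j\<in>UNIV. v i j * (\<chi> j. z $ j / c) $ j)) powr (x $ i))) UNIV"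
    by (rule has_sum_row_coeff)
  then have outer: "((\<lambda>A. c powr (- \<beta>) * (row_coeff v x A * multi_power (\<chi> j. z $ j / c) (col_sum A))) has_sum
      c powr (- \<beta>) * (\<Prod>i\<in>UNIV. (1 + (\<Sum>j\<in>UNIV. v i j * (z $ j / c))) powr (x $ i))) UNIV"
    by (intro has_sum_cmult_right) simp
  have inner: "((\<lambda>k. f (A, k)) has_sum
      c powr (- \<beta>) * (row_coeff v x A * multi_power (\<chi> j. z $ j / c) (col_sum A))) UNIV" for A
  proof -
    \<comment> \<open>The extra power of \<open>c\<close> turns the monomial in \<open>z\<close>
      into one in \<open>z / c\<close>.\<close>
    have "c powr (- (\<beta> + of_nat (coord_sum (col_sum A)))) = c powr (- \<beta>) / c ^ coord_sum (col_sum A)"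
      using \<open>c \<noteq> 0\<close> by (simp add: powr_diff powr_nat')
    then show ?thesis
      using has_sum_cmult_right[OF has_sum_multinomial_series[of "\<lambda>j. z $ j"
          "\<beta> + of_nat (coord_sum (col_sum A))"], of "row_coeff v x A * multi_power z (col_sum A)"] r
      by (simp add: f_def r_def c_def coord_sum_def multi_power_divide mult_ac)
  qed
  have "(\<lambda>p. norm (f p)) summable_on UNIV \<times> UNIV"
  proof -
    define b where "b A = norm \<beta> + real (coord_sum (col_sum A))" for A :: "nat ^ 'd ^ 'd"
    define g where "g = (\<lambda>(A :: nat ^ 'd ^ 'd, k :: nat ^ 'd).
      norm (row_coeff v x A * multi_power z (col_sum A)) *
        (pochhammer (b A) (coord_sum k) * (\<Prod>i\<in>UNIV. norm (z $ i) ^ (k $ i) / fact (k $ i))))"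
    have le: "norm (f p) \<le> g p" for p
    proof (cases p)
      case (Pair A k)
      have "norm (pochhammer (\<beta> + of_nat (coord_sum (col_sum A))) (coord_sum k)) \<le>
          pochhammer (b A) (coord_sum k)"
        unfolding b_def by (intro norm_pochhammer_le) (metis norm_of_nat norm_triangle_ineq)
      then show ?thesis
        unfolding Pair f_def g_def
        by (auto simp: norm_mult norm_divide norm_power simp flip: prod_norm
            intro!: mult_left_mono mult_right_mono prod_nonneg)
    qed
    \<comment> \<open>The moduli of \<open>z\<close> rescaled by the real number
      \<open>1 - r\<close>, in the shape of \<open>multi_power_divide\<close>: at
      \<open>\<omega>\<close> the norms of the row series reproduce the inner sums of
      \<open>g\<close>.\<close>
    define \<omega> :: "complex ^ 'd" where "\<omega> = (\<chi> j. (\<chi> j. of_real (norm (z $ j))) $ j / of_real (1 - r))"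
    have \<omega>: "norm (multi_power \<omega> m) = norm (multi_power z m) / (1 - r) ^ coord_sum m" for m
      unfolding \<omega>_def multi_power_divide using r
      by (simp add: norm_divide norm_power multi_power_def flip: prod_norm of_real_diff)
    have "norm (\<omega> $ j) = norm (z $ j) / (1 - r)" for j
      using r by (simp add: \<omega>_def norm_divide flip: of_real_diff)
    then have "(\<Sum>j\<in>UNIV. norm (v i j * \<omega> $ j)) < 1" for i
      using v[of i] by (simp add: norm_mult)
    from has_sum_imp_summable[OF has_sum_row_coeff[OF this]]
    have summ: "(\<lambda>A. (1 - r) powr (- norm \<beta>) * norm (row_coeff v x A * multi_power \<omega> (col_sum A)))
        summable_on UNIV"
      by (intro summable_on_cmult_right) (simp only: summable_on_iff_abs_summable_on_complex)
    have "g summable_on UNIV \<times> UNIV"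
    proof (rule summable_on_SigmaI[OF _ summ])
      fix A :: "nat ^ 'd ^ 'd"
      have "(1 - r) powr (- b A) = (1 - r) powr (- norm \<beta>) / (1 - r) ^ coord_sum (col_sum A)"
        using r by (simp add: b_def powr_diff powr_realpow)
      then show "((\<lambda>k. g (A, k)) has_sum
          (1 - r) powr (- norm \<beta>) * norm (row_coeff v x A * multi_power \<omega> (col_sum A))) UNIV"
        using has_sum_cmult_right[OF has_sum_multinomial_series_real[of "\<lambda>j. norm (z $ j)" "b A"],
            of "norm (row_coeff v x A * multi_power z (col_sum A))"] r
        by (simp add: g_def r_def norm_mult \<omega> mult_ac)
    next
      show "0 \<le> g (A, k)" for A k
        using order_trans[OF norm_ge_zero le] .
    qed
    then show ?thesis
      by (rule Infinite_Sum.abs_summable_on_comparison_test'[OF _ le])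
  qed
  then have "f summable_on UNIV \<times> UNIV"
    by (rule abs_summable_summable)
  from has_sum_SigmaI[OF inner outer this] show ?thesis
    by (simp add: f_eq)
qed

section \<open>Regrouping by the exponent of \<open>z\<close>\<close>

lemma has_sum_meixner_term:
  fixes z :: "complex ^ 'd::finite" and v :: "'d \<Rightarrow> 'd \<Rightarrow> complex"
  defines "r \<equiv> \<Sum>j\<in>UNIV. norm (z $ j)"
  defines "c \<equiv> 1 - coord_sum z"
  assumes \<beta>: "\<beta> \<notin> \<int>\<^sub>\<le>\<^sub>0"
    and r: "r < 1" and v: "\<And>i. (\<Sum>j\<in>UNIV. norm (v i j) * (norm (z $ j) / (1 - r))) < 1"
  shows "((\<lambda>n. pochhammer \<beta> (coord_sum n) / multi_fact n *
            (\<Sum>\<^sub>\<infinity>A\<in>UNIV. meixner_term \<beta> v x n A) * multi_power z n) has_sum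
          c powr (- \<beta>) * (\<Prod>i\<in>UNIV. (1 + (\<Sum>j\<in>UNIV. v i j * (z $ j / c))) powr (x $ i))) UNIV"
    (is "(_ has_sum ?s) _")
proof -
  define h where "h n = pochhammer \<beta> (coord_sum n) / multi_fact n" for n :: "nat ^ 'd"
  let ?G = "\<lambda>n A. h n * meixner_term \<beta> v x n A * multi_power z n"
  have "((\<lambda>(A, k). row_coeff v x A * pochhammer (\<beta> + of_nat (coord_sum (col_sum A))) (coord_sum k) /
            multi_fact k * multi_power z (k + col_sum A)) has_sum ?s) (UNIV \<times> UNIV)"
    using r v unfolding r_def c_def by (rule has_sum_double_series)
  \<comment> \<open>Substituting \<open>n = k + col_sum A\<close>; on
    \<open>col_sum A \<le> n\<close> truncated subtraction is the inverse.\<close>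
  also have "?this \<longleftrightarrow> ((\<lambda>(A, n). ?G n A) has_sum ?s) (SIGMA A : UNIV. {n. col_sum A \<le> n})"
  proof (rule has_sum_reindex_bij_witness[of _ "\<lambda>(A, n). (A, n - col_sum A)" "\<lambda>(A, k). (A, k + col_sum A)"])
    fix p :: "(nat ^ 'd ^ 'd) \<times> (nat ^ 'd)"
    show "(case case p of (A, k) \<Rightarrow> (A, k + col_sum A) of (A, n) \<Rightarrow> ?G n A) =
        (case p of (A, k) \<Rightarrow> row_coeff v x A *
           pochhammer (\<beta> + of_nat (coord_sum (col_sum A))) (coord_sum k) / multi_fact k *
           multi_power z (k + col_sum A))"
      by (cases p) (simp only: h_def prod.case meixner_term_add_col_sum[OF \<beta>])
  qed (auto simp: vec_eq_iff less_eq_vec_def)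
  also have "\<dots> \<longleftrightarrow> ((\<lambda>(A, n). ?G n A) has_sum ?s) (UNIV \<times> UNIV)"
    by (rule has_sum_cong_neutral) (use meixner_term_eq_0 in fastforce)+
  also have "\<dots> \<longleftrightarrow> ((\<lambda>(n, A). ?G n A) has_sum ?s) (UNIV \<times> UNIV)"
    by (subst has_sum_swap) simp
  finally have "((\<lambda>n. h n * (\<Sum>\<^sub>\<infinity>A\<in>UNIV. meixner_term \<beta> v x n A) * multi_power z n) has_sum ?s) UNIV"
  proof (rule has_sum_SigmaD)
    fix n :: "nat ^ 'd"
    \<comment> \<open>Only finitely many matrices contribute for fixed \<open>n\<close>, so the
      inner sum exists.\<close>
    have "(meixner_term \<beta> v x n has_sum (\<Sum>\<^sub>\<infinity>A\<in>UNIV. meixner_term \<beta> v x n A)) UNIV"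
      using finite_meixner_term[of \<beta> v x n] by (simp add: finite_nonzero_values_imp_summable_on)
    then show "((\<lambda>A. case (n, A) of (n, A) \<Rightarrow> ?G n A) has_sum
        h n * (\<Sum>\<^sub>\<infinity>A\<in>UNIV. meixner_term \<beta> v x n A) * multi_power z n) UNIV"
      by (auto intro!: has_sum_cmult_left has_sum_cmult_right)
  qed
  then show ?thesis
    by (simp only: h_def)
qed

lemma meixner_expansion_meixner_term:
  fixes U :: "complex ^ 'd::finite option ^ 'd option"
  assumes \<beta>: "\<beta> \<notin> \<int>\<^sub>\<le>\<^sub>0"
  shows "meixner_expansion (c0, C, C', U) \<beta> x
    (\<lambda>n. \<Sum>\<^sub>\<infinity>A\<in>UNIV. meixner_term \<beta> (\<lambda>i j. 1 - U $ Some i $ Some j) x n A)"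
  unfolding meixner_expansion_def
proof -
  define v where "v = (\<lambda>i j. 1 - U $ Some i $ Some j)"
  define r where "r z = (\<Sum>j\<in>UNIV. norm (z $ j))" for z :: "complex ^ 'd"
  have r0: "(r \<longlongrightarrow> 0) (nhds 0)"
    unfolding r_def by (rule tendsto_eq_rhs, (rule tendsto_intros filterlim_ident)+) auto
  have z0: "((\<lambda>z :: complex ^ 'd. norm (z $ j)) \<longlongrightarrow> 0) (nhds 0)" for j
    by (rule tendsto_eq_rhs, (rule tendsto_intros filterlim_ident)+) auto
  \<comment> \<open>As \<open>z\<close> tends to \<open>0\<close>, \<open>1 - r z\<close> tends to
    \<open>1\<close> and the numerators to \<open>0\<close>; finitely many rows then satisfy the
    bound on a common neighbourhood.\<close>
  have "((\<lambda>z. \<Sum>j\<in>UNIV. norm (v i j) * (norm (z $ j) / (1 - r z))) \<longlongrightarrow> 0) (nhds 0)" for i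
    by (rule tendsto_eq_rhs, (rule tendsto_intros r0 z0)+) auto
  then have "\<forall>\<^sub>F z in nhds 0. (\<Sum>j\<in>UNIV. norm (v i j) * (norm (z $ j) / (1 - r z))) < 1" for i
    by (rule order_tendstoD) simp
  then have "\<forall>\<^sub>F z in nhds 0. \<forall>i. (\<Sum>j\<in>UNIV. norm (v i j) * (norm (z $ j) / (1 - r z))) < 1"
    by (rule eventually_all_finite)
  moreover have "\<forall>\<^sub>F z in nhds 0. r z < 1"
    using r0 by (rule order_tendstoD) simp
  ultimately show "\<forall>\<^sub>F z in nhds 0.
      ((\<lambda>n. pochhammer \<beta> (coord_sum n) / multi_fact n *
          (\<Sum>\<^sub>\<infinity>A\<in>UNIV. meixner_term \<beta> (\<lambda>i j. 1 - U $ Some i $ Some j) x n A) * multi_power z n)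
        has_sum meixner_gen (c0, C, C', U) \<beta> x z) UNIV"
  proof eventually_elim
    case (elim z)
    define c where "c = 1 - coord_sum z"
    have "Re c > 0" and "\<And>i. (\<Sum>j\<in>UNIV. norm (v i j * (\<chi> j. z $ j / c) $ j)) < 1"
      using Re_one_minus_coord_sum_pos[of z] sum_norm_rescaled_less_1[of z] elim
      by (auto simp: r_def c_def)
    then have "meixner_gen (c0, C, C', U) \<beta> x z =
        c powr (- \<beta>) * (\<Prod>i\<in>UNIV. (1 + (\<Sum>j\<in>UNIV. v i j * (z $ j / c))) powr (x $ i))"
      unfolding c_def v_def by (subst meixner_gen_eq) auto
    with has_sum_meixner_term[OF \<beta>, of z v x] elim show ?case
      by (simp add: r_def v_def c_def)
  qed
qed

section \<open>Uniqueness of the expansion and the explicit formula\<close>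

lemma meixner_expansion_unique:
  fixes \<beta> :: complex
  assumes \<beta>: "\<beta> \<notin> \<int>\<^sub>\<le>\<^sub>0" and "meixner_expansion \<mm> \<beta> x p" "meixner_expansion \<mm> \<beta> x q"
  shows "p = q"
proof
  fix n
  define h where "h n = pochhammer \<beta> (coord_sum n) / multi_fact n" for n :: "nat ^ 'a"
  have "\<forall>\<^sub>F z in nhds 0. ((\<lambda>n. h n * (p n - q n) * multi_power z n) has_sum 0) UNIV"
    using assms(2,3) unfolding meixner_expansion_def
  proof eventually_elim
    case (elim z)
    from has_sum_add[OF elim(1) has_sum_uminusI[OF elim(2)]] show ?case
      by (simp only: h_def right_diff_distrib left_diff_distrib add_uminus_conv_diff diff_self)
  qed
  then have "h n * (p n - q n) = 0"
    by (rule multi_powser_zero_imp_coeff_zero)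
  \<comment> \<open>No factor of the Pochhammer symbol vanishes, so the coefficient determines the
    polynomial value.\<close>
  moreover have "h n \<noteq> 0"
    using \<beta> by (auto simp: h_def multi_fact_def pochhammer_eq_0_iff)
  ultimately show "p n = q n" by simp
qed

theorem theorem3p1:
  fixes c0 \<beta> :: complex
    and C C' U :: "complex ^ ('d::finite) option ^ 'd option"
    and n :: "nat ^ 'd"
    and x :: "complex ^ 'd"
  assumes "(c0, C, C', U) \<in> meixner_params"
    and "\<beta> \<notin> \<int>\<^sub>\<le>\<^sub>0"
  shows "let T = (\<lambda>A :: nat ^ 'd ^ 'd.
             (\<Prod>j\<in>UNIV. pochhammer (- of_nat (n $ j)) (\<Sum>i\<in>UNIV. A $ i $ j)) *
             (\<Prod>i\<in>UNIV. pochhammer (- x $ i) (\<Sum>j\<in>UNIV. A $ i $ j)) /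
             pochhammer \<beta> (\<Sum>i\<in>UNIV. \<Sum>j\<in>UNIV. A $ i $ j) *
             (\<Prod>i\<in>UNIV. \<Prod>j\<in>UNIV.
                (1 - U $ Some i $ Some j) ^ (A $ i $ j) / fact (A $ i $ j)))
         in finite {A. T A \<noteq> 0} \<and>
            meixner_poly (c0, C, C', U) \<beta> n x = (\<Sum>\<^sub>\<infinity>A\<in>UNIV. T A)"
proof -
  define T where "T = (\<lambda>n. meixner_term \<beta> (\<lambda>i j. 1 - U $ Some i $ Some j) x n)"
  \<comment> \<open>Existence and uniqueness of the expansion together evaluate the definite
    description.\<close>
  have "(THE p. meixner_expansion (c0, C, C', U) \<beta> x p) = (\<lambda>n. \<Sum>\<^sub>\<infinity>A\<in>UNIV. T n A)"
    unfolding T_def using meixner_expansion_meixner_term[OF assms(2)] meixner_expansion_unique[OF assms(2)]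
    by (intro the_equality) blast+
  then have "meixner_poly (c0, C, C', U) \<beta> n x = (\<Sum>\<^sub>\<infinity>A\<in>UNIV. T n A)"
    by (simp add: meixner_poly_def)
  moreover have "finite {A. T n A \<noteq> 0}"
    unfolding T_def by (rule finite_meixner_term)
  ultimately show ?thesis
    unfolding Let_def T_def meixner_term_def by blast
qed

end
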